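(* For any $k\ge 1$, $Q_k$ equals the set of all vectors $q=b_0+\cdots+b_m$ arising from finite sequences of edges $\{(u_i,u_{i+1};b_i)\}_{i=0}^{m}$, $m\ge 0$, of the following kind: - if $m=0$: $(u_0,u_1;b_0)\in\widetilde{\mathcal{G}}_{Q_{k-1}}$; - if $m=1$: $(u_0,u_1;b_0)\in\mathcal{G}'_{Q_{k-1}}$ and $(u_1,u_2;b_1)\in\mathcal{G}''_{Q_{k-1}}$; - if $m\ge 2$: $(u_0,u_1;b_0)\in\mathcal{G}'_{Q_{k-1}}$, $\{(u_i,u_{i+1};b_i)\}_{i=1}^{m-1}\subset\mathcal{G}_{Q_{k-1}}$, and $(u_m,u_{m+1};b_m)\in\mathcal{G}''_{Q_{k-1}}$.
   Context: Let $n\ge 2$ be an integer and $\mathcal{D}\subset\{0,1,\dots,n-1\}^2$ with $1<\#\mathcal{D}<n^2$. Let $I=[0,1]^2$ with interior $I^\circ$, $F_1=(I+\mathcal{D})/n$, and $F_{k+1}=(F_k+\mathcal{D})/n$ for $k\ge1$. For $q\in\mathbb{Z}^2$ and $k\ge 1$ let $H_k(0,q)=F_k+(\mathbb{Z}^2\setminus\{0,q\})$ and let $H_k^c(0,q)$ be its complement in $\mathbb{R}^2$. For $k\ge1$, $Q_k$ is the set of $q\in\mathbb{Z}^2$ such that some connected component of $H_k^c(0,q)$ contains both $I^\circ$ and $q+I^\circ$ (admissible vectors of order $k$). By convention $Q_0=\{0,\pm e_1,\pm e_2\}$, where $e_1=(1,0)$, $e_2=(0,1)$. Let $\mathcal{D}^c=\{0,\dots,n-1\}^2\setminus\mathcal{D}$,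 $\mathcal{V}=\mathcal{D}^c/n$ and $\widetilde{\mathcal{V}}=\{h/n:h\in\{0,\dots,n-1\}^2\}$. For $Q\subset\mathbb{Z}^2$ with $0\in Q$, and $u,v\in\widetilde{\mathcal{V}}$, $b\in\mathbb{Z}^2$, the triple $(u,v;b)$ is called an edge $b$ from $u$ to $v$ (relative to $Q$) if $n(v+b-u)\in Q$. Define the edge sets: $\widetilde{\mathcal{G}}_Q$ = all edges with $u,v\in\widetilde{\mathcal{V}}$; $\mathcal{G}_Q$ = all edges with $u,v\in\mathcal{V}$; $\mathcal{G}'_Q$ = all edges with $u\in\widetilde{\mathcal{V}}$, $v\in\mathcal{V}$; $\mathcal{G}''_Q$ = all edges with $u\in\mathcal{V}$, $v\in\widetilde{\mathcal{V}}$. *)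

theory Defs
  imports "HOL-Analysis.Analysis"
begin

type_synonym plane = "real \<times> real"
type_synonym lattice = "int \<times> int"

definition emb :: "lattice \<Rightarrow> plane" where
  "emb z = (real_of_int (fst z), real_of_int (snd z))"

definition digits :: "nat \<Rightarrow> lattice set" where
  "digits n = {0..int n - 1} \<times> {0..int n - 1}"

definition unit_square :: "plane set" where
  "unit_square = {0..1} \<times> {0..1}"

text \<open>The recursion is started one step early, at \<open>F\<^sub>0 = I\<close>, so that
  \<open>F\<^sub>1 = (I + D) / n\<close>.\<close>

primrec approx :: "nat \<Rightarrow> lattice set \<Rightarrow> nat \<Rightarrow> plane set" where
  "approx n D 0 = unit_square"
| "approx n D (Suc k) = {(x + emb d) /\<^sub>R real n | x d. x \<in> approx n D k \<and> d \<in> D}"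

text \<open>\<open>H\<^sub>k(0,q) = F\<^sub>k + (\<int>\<^sup>2 - {0,q})\<close>.\<close>

definition H :: "nat \<Rightarrow> lattice set \<Rightarrow> nat \<Rightarrow> lattice \<Rightarrow> plane set" where
  "H n D k q = {x + emb z | x z. x \<in> approx n D k \<and> z \<notin> {0, q}}"

text \<open>The set \<open>Q\<^sub>k\<close> of admissible vectors of order \<open>k\<close>; order \<open>0\<close> is a convention
  and not an instance of the general clause.\<close>

definition admissible :: "nat \<Rightarrow> lattice set \<Rightarrow> nat \<Rightarrow> lattice set" where
  "admissible n D k =
    (if k = 0 then {(0, 0), (1, 0), (-1, 0), (0, 1), (0, -1)}
     else {q. \<exists>C \<in> components (- H n D k q).
                interior unit_square \<subseteq> C \<and> (\<lambda>x. emb q + x) ` interior unit_square \<subseteq> C})"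

definition Vtilde :: "nat \<Rightarrow> plane set" where
  "Vtilde n = (\<lambda>h. emb h /\<^sub>R real n) ` digits n"

definition V :: "nat \<Rightarrow> lattice set \<Rightarrow> plane set" where
  "V n D = (\<lambda>h. emb h /\<^sub>R real n) ` (digits n - D)"

text \<open>A triple \<open>(u, v, b)\<close> is an edge \<open>b\<close> from \<open>u\<close> to \<open>v\<close> relative to \<open>Q\<close>.\<close>

definition is_edge :: "nat \<Rightarrow> lattice set \<Rightarrow> plane \<times> plane \<times> lattice \<Rightarrow> bool" where
  "is_edge n Q = (\<lambda>(u, v, b). real n *\<^sub>R (v + emb b - u) \<in> emb ` Q)"

text \<open>The edge sets written with a tilde, without decoration, with one prime and with two
  primes, respectively.\<close>

definition Gtilde :: "nat \<Rightarrow> lattice set \<Rightarrow> (plane \<times> plane \<times> lattice) set" where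
  "Gtilde n Q = {(u, v, b). u \<in> Vtilde n \<and> v \<in> Vtilde n \<and> is_edge n Q (u, v, b)}"

definition G :: "nat \<Rightarrow> lattice set \<Rightarrow> lattice set \<Rightarrow> (plane \<times> plane \<times> lattice) set" where
  "G n D Q = {(u, v, b). u \<in> V n D \<and> v \<in> V n D \<and> is_edge n Q (u, v, b)}"

definition G' :: "nat \<Rightarrow> lattice set \<Rightarrow> lattice set \<Rightarrow> (plane \<times> plane \<times> lattice) set" where
  "G' n D Q = {(u, v, b). u \<in> Vtilde n \<and> v \<in> V n D \<and> is_edge n Q (u, v, b)}"

definition G'' :: "nat \<Rightarrow> lattice set \<Rightarrow> lattice set \<Rightarrow> (plane \<times> plane \<times> lattice) set" where
  "G'' n D Q = {(u, v, b). u \<in> V n D \<and> v \<in> Vtilde n \<and> is_edge n Q (u, v, b)}"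

end

theory Submission
  imports Defs
begin

text \<open>Scaling by \<open>n\<close> turns \<open>H\<^sub>k\<^sub>+\<^sub>1\<close> into copies of \<open>F\<^sub>k\<close> placed at the blocked lattice cells, those
  with residue in \<open>D\<close> outside the supercells of \<open>0\<close> and \<open>q\<close>. A chain of unblocked cells with steps in
  \<open>Q\<^sub>k\<close> connects the two supercells in the complement, because each step does.

  Conversely, let \<open>C\<close> be the set of unblocked cells reachable from a given one. For a cell \<open>c\<close> let
  \<open>N c\<close> be the component of the cell in the complement of all copies of \<open>F\<^sub>k\<close> except the one at \<open>c\<close>.
  If \<open>N c\<close> and \<open>N c'\<close> meet, then \<open>c' - c\<close> is in \<open>Q\<^sub>k\<close>, so the sets \<open>N c\<close> belonging to \<open>C\<close> are
  disjoint from those of the other unblocked cells. Of the complement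
  of the blocked copies they miss only an open set of points in no copy of \<open>F\<^sub>k\<close>, and the points
  lying in several copies. Lattice points are countably many and removing them does not disconnect an open connected
  set; any other point in several copies is on the common side of two adjacent cells, which are both in \<open>C\<close> or
  both outside. This separates \<open>C\<close> from the other unblocked cells by open sets. A shortest chain
  between the two supercells avoids them in its interior, so its residues there are not in \<open>D\<close>.\<close>

section \<open>Lattice cells and lattice translates of a plane set\<close>

definition tiles :: "plane set \<Rightarrow> lattice set \<Rightarrow> plane set" where
  "tiles F B = {x. \<exists>z\<in>B. x - emb z \<in> F}"

definition cell :: "lattice \<Rightarrow> plane set" where
  "cell z = {real_of_int (fst z)..real_of_int (fst z) + 1} \<times> {real_of_int (snd z)..real_of_int (snd z) + 1}"

definition open_cell :: "lattice \<Rightarrow> plane set" where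
  "open_cell z = {real_of_int (fst z)<..<real_of_int (fst z) + 1} \<times> {real_of_int (snd z)<..<real_of_int (snd z) + 1}"

definition centre :: "lattice \<Rightarrow> plane" where
  "centre z = emb z + (1/2, 1/2)"

lemma emb_simps:
  "emb 0 = 0" "emb (x + y) = emb x + emb y" "emb (x - y) = emb x - emb y" "emb (- x) = - emb x"
  by (auto simp: emb_def zero_prod_def)

lemma inj_emb: "inj emb"
  by (auto simp: emb_def inj_def prod_eq_iff)

lemma mem_cell: "x \<in> cell z \<longleftrightarrow> x - emb z \<in> unit_square"
  by (cases x) (auto simp: cell_def unit_square_def emb_def)

lemma interior_unit_square: "interior unit_square = open_cell 0"
  by (simp add: unit_square_def open_cell_def interior_Times)

lemma translate_open_cell: "(\<lambda>x. emb z + x) ` open_cell w = open_cell (z + w)"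
proof (intro equalityI subsetI)
  fix x assume "x \<in> open_cell (z + w)"
  then have "x - emb z \<in> open_cell w"
    by (cases x) (auto simp: open_cell_def emb_def)
  then show "x \<in> (\<lambda>x. emb z + x) ` open_cell w"
    by (rule rev_image_eqI) simp
qed (auto simp: open_cell_def emb_def)

lemma centre_in_open_cell: "centre z \<in> open_cell z"
  by (simp add: centre_def open_cell_def emb_def)

lemma open_cell_subset_cell: "open_cell z \<subseteq> cell z"
  by (auto simp: open_cell_def cell_def)

lemma cell_subset_closure: "cell z \<subseteq> closure (open_cell z)"
  by (simp add: cell_def open_cell_def closure_Times)

lemma connected_open_cell: "connected (open_cell z)"
  by (simp add: open_cell_def convex_Times convex_connected)

lemma open_cell_inter_cell: "x \<in> open_cell z \<Longrightarrow> x \<in> cell w \<Longrightarrow> w = z"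
  by (auto simp: open_cell_def cell_def prod_eq_iff)

lemma obtain_cell: obtains z where "x \<in> cell z"
proof (rule that)
  show "x \<in> cell (\<lfloor>fst x\<rfloor>, \<lfloor>snd x\<rfloor>)"
    using floor_correct[of "fst x"] floor_correct[of "snd x"]
    by (cases x) (auto simp: cell_def)
qed

text \<open>A point off the lattice has a non-integer coordinate, which fixes that coordinate of
  every cell containing it. The other coordinate leaves at most two consecutive values, so the cells
  share a side and there is no third one.\<close>

lemma two_cells:
  assumes "x \<notin> range emb" "x \<in> cell z" "x \<in> cell w" "z \<noteq> w"
  shows "w - z \<in> {(1, 0), (-1, 0), (0, 1), (0, -1)}" "x \<in> cell v \<Longrightarrow> v \<in> {z, w}"
proof -
  obtain a b where x: "x = (a, b)" by fastforce
  have nl: "\<not> (a = real_of_int i \<and> b = real_of_int j)" for i j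
    using assms(1) by (auto simp: x emb_def image_iff)
  have bounds: "real_of_int (fst v) \<le> a \<and> a \<le> real_of_int (fst v) + 1 \<and>
     real_of_int (snd v) \<le> b \<and> b \<le> real_of_int (snd v) + 1" if "x \<in> cell v" for v
    using that by (auto simp: x cell_def)
  have fl: "(fst v = \<lfloor>a\<rfloor> \<or> fst v = \<lfloor>a\<rfloor> - 1 \<and> a = of_int \<lfloor>a\<rfloor>) \<and>
      (snd v = \<lfloor>b\<rfloor> \<or> snd v = \<lfloor>b\<rfloor> - 1 \<and> b = of_int \<lfloor>b\<rfloor>)" if "x \<in> cell v" for v
    using bounds[OF that] by linarith
  have *: "a \<noteq> of_int \<lfloor>a\<rfloor> \<or> b \<noteq> of_int \<lfloor>b\<rfloor>" using nl by blast
  show "w - z \<in> {(1, 0), (-1, 0), (0, 1), (0, -1)}"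
    using fl[OF assms(2)] fl[OF assms(3)] * assms(4)
    by (cases z; cases w) auto
  show "v \<in> {z, w}" if "x \<in> cell v"
    using fl[OF assms(2)] fl[OF assms(3)] fl[OF that] * assms(4)
    by (cases z; cases w; cases v) auto
qed

lemma tiles_mono: "B \<subseteq> B' \<Longrightarrow> tiles F B \<subseteq> tiles F B'"
  by (auto simp: tiles_def)

lemma closed_emb_image: "closed (emb ` B)"
proof (rule discrete_imp_closed)
  show "\<forall>x\<in>emb ` B. \<forall>y\<in>emb ` B. dist y x < 1 \<longrightarrow> y = x"
  proof (intro ballI impI)
    fix x y assume "x \<in> emb ` B" "y \<in> emb ` B" and d: "dist y x < 1"
    then obtain z w where zw: "x = emb z" "y = emb w" by blast
    have "dist (real_of_int (fst w)) (real_of_int (fst z)) < 1"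
      "dist (real_of_int (snd w)) (real_of_int (snd z)) < 1"
      using d dist_fst_le[of y x] dist_snd_le[of y x] by (auto simp: emb_def zw)
    then show "y = x"
      by (auto simp: dist_real_def emb_def zw)
  qed
qed simp

text \<open>The set is the Minkowski sum of a compact set and a closed one.\<close>

lemma closed_tiles:
  assumes "compact F"
  shows "closed (tiles F B)"
proof -
  have "tiles F B = (\<Union>x\<in>F. \<Union>y\<in>emb ` B. {x + y})"
    by (force simp: tiles_def)
  with compact_closed_sums[OF assms closed_emb_image] show ?thesis
    by simp
qed

text \<open>Each copy of \<open>F\<close> stays inside its own closed cell, and an open cell meets
  no closed cell but its own.\<close>

lemma open_cell_inter_tiles:
  assumes "F \<subseteq> unit_square" "c \<notin> B"
  shows "open_cell c \<inter> tiles F B = {}"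
proof -
  have "w = c" if "x \<in> open_cell c" "x - emb w \<in> F" for x w
    using that assms(1) open_cell_inter_cell[of x c w] by (auto simp: mem_cell)
  with assms(2) show ?thesis
    by (fastforce simp: tiles_def)
qed

section \<open>Components around single cells, and the separation argument\<close>

text \<open>Adjoining a point of its closure to the open cell keeps it connected, so uncovered
  boundary points of a cell also belong to its component.\<close>

lemma component_cell:
  assumes "F \<subseteq> unit_square" "c \<notin> B" "x \<in> cell c" "x \<notin> tiles F B"
  shows "connected_component (- tiles F B) (centre c) x"
proof -
  have "connected (insert x (open_cell c))"
    using cell_subset_closure assms(3) closure_subset
    by (intro connected_intermediate_closure[OF connected_open_cell]) blast+
  then show ?thesis
    unfolding connected_component_def
    using open_cell_inter_tiles[OF assms(1,2)] assms(4) centre_in_open_cell by blast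
qed


text \<open>All points in components of single opened cells of \<open>C\<close>; the second part adds the points on
  the common side of two cells of \<open>C\<close> where both copies of \<open>F\<close> meet, together with a whole
  neighbourhood of each, so that the result is open.\<close>

definition nbhd :: "plane set \<Rightarrow> lattice set \<Rightarrow> plane set" where
  "nbhd F C = (\<Union>c\<in>C. connected_component_set (- tiles F (- {c})) (centre c)) \<union>
     (\<Union>c\<in>C. \<Union>c'\<in>C. - tiles unit_square (- {c, c'}))"

lemma compact_unit_square: "compact unit_square"
  by (simp add: unit_square_def compact_Times)

lemma open_component_tiles:
  "compact F \<Longrightarrow> open (connected_component_set (- tiles F B) x)"
  by (simp add: closed_tiles open_Compl open_connected_component)

lemma open_nbhd: "compact F \<Longrightarrow> open (nbhd F C)"
  unfolding nbhd_def
  by (intro open_Un open_UN ballI open_component_tiles open_Compl closed_tiles compact_unit_square)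

lemma component_tiles_unique:
  assumes "connected_component (- tiles F (- {c})) (centre c) x" "x - emb z \<in> F"
  shows "z = c"
  using connected_component_in[OF assms(1)] assms(2) by (auto simp: tiles_def)

text \<open>Points of the second part of \<open>nbhd\<close> lie only in cells of \<open>C\<close>.
  Such a point is either in some copy of \<open>F\<close>, and then all copies containing it have
  index in \<open>C\<close>, or in none, and then it joins the component of any cell containing
  it.\<close>

lemma nbhd_cases:
  assumes F: "F \<subseteq> unit_square" and x: "x \<in> nbhd F C"
  obtains c where "c \<in> C" "connected_component (- tiles F (- {c})) (centre c) x"
  | c where "c \<in> C" "x - emb c \<in> F" "\<And>z. x - emb z \<in> F \<Longrightarrow> z \<in> C"
proof -
  consider c where "c \<in> C" "connected_component (- tiles F (- {c})) (centre c) x"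
    | c c' where "c \<in> C" "c' \<in> C" "x \<notin> tiles unit_square (- {c, c'})"
    using x by (auto simp: nbhd_def)
  then show ?thesis
  proof cases
    case 2
    from 2(3) have cells: "z = c \<or> z = c'" if "x \<in> cell z" for z
      using that by (auto simp: tiles_def mem_cell)
    have tiles: "z = c \<or> z = c'" if "x - emb z \<in> F" for z
      using that cells[of z] F by (auto simp: mem_cell)
    obtain z where z: "x \<in> cell z" by (rule obtain_cell)
    show ?thesis
    proof (cases "\<exists>v. x - emb v \<in> F")
      case True
      then show ?thesis using that(2) tiles 2(1,2) by blast
    next
      case False
      then have "x \<notin> tiles F (- {z})" by (auto simp: tiles_def)
      then have "connected_component (- tiles F (- {z})) (centre z) x"
        using component_cell[OF F _ z] by simp
      then show ?thesis using that(1) cells[OF z] 2(1,2) by blast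
    qed
  qed (use that in blast)
qed

text \<open>Two points of component type are excluded by \<open>sep\<close>. In every other
  combination a copy of \<open>F\<close> containing the common point would have its index in both
  \<open>C\<close> and \<open>C'\<close>.\<close>

lemma disjoint_nbhd:
  assumes F: "F \<subseteq> unit_square" and CC': "C \<inter> C' = {}"
    and sep: "\<And>c c' x. c \<in> C \<Longrightarrow> c' \<in> C' \<Longrightarrow>
      connected_component (- tiles F (- {c})) (centre c) x \<Longrightarrow>
      connected_component (- tiles F (- {c'})) (centre c') x \<Longrightarrow> False"
  shows "nbhd F C \<inter> nbhd F C' = {}"
proof (rule ccontr)
  assume "\<not> ?thesis"
  then obtain x where x: "x \<in> nbhd F C" "x \<in> nbhd F C'" by blast
  show False
    using nbhd_cases[OF F x(1)]
  proof cases
    case (1 c)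
    show False using nbhd_cases[OF F x(2)]
      by cases (use 1 CC' sep component_tiles_unique in blast)+
  next
    case (2 c)
    show False using nbhd_cases[OF F x(2)]
      by cases (use 2 CC' sep component_tiles_unique in blast)+
  qed
qed

text \<open>If \<open>a'\<close> were not reachable, the reachable cells and the remaining unblocked
  ones would yield two disjoint open sets that disconnect \<open>X\<close>. The two conditions on
  \<open>Q\<close> match the two ways in which these sets could touch: across a common side, or
  through components that meet.\<close>

lemma chain_if_connected:
  assumes F: "compact F" "F \<subseteq> unit_square"
    and Q: "{(1, 0), (-1, 0), (0, 1), (0, -1)} \<subseteq> Q"
      "\<And>c c' x. connected_component (- tiles F (- {c})) (centre c) x \<Longrightarrow>
        connected_component (- tiles F (- {c'})) (centre c') x \<Longrightarrow> c' - c \<in> Q"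
    and a: "a \<notin> B" "a' \<notin> B"
    and conn: "connected_component (- tiles F B) (centre a) (centre a')"
  shows "(a, a') \<in> {(c, c'). c \<notin> B \<and> c' \<notin> B \<and> c' - c \<in> Q}\<^sup>*" (is "_ \<in> ?r\<^sup>*")
proof (rule ccontr)
  assume na: "(a, a') \<notin> ?r\<^sup>*"
  define C where "C = {c. (a, c) \<in> ?r\<^sup>*}"
  define C' where "C' = - B - C"
  have CB: "c \<notin> B" if "c \<in> C" for c
    using that a(1) unfolding C_def by (auto elim: rtranclE)
  have step: "c' \<in> C" if "c \<in> C" "c' \<notin> B" "c' - c \<in> Q" for c c'
    using that CB[OF that(1)] unfolding C_def
    by (auto intro: rtrancl_into_rtrancl)
  define N where "N = (\<lambda>c. connected_component_set (- tiles F (- {c})) (centre c))"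
  \<comment> \<open>The uncovered points that no unblocked cell reaches. They are needed to cover
    \<open>X\<close> and are put on the side of \<open>C'\<close>.\<close>
  define L where "L = - tiles F UNIV - (\<Union>c\<in>- B. N c)"
  \<comment> \<open>Four copies of \<open>F\<close> may meet at a lattice point, and diagonal cells
    need not differ by a vector of \<open>Q\<close>; so lattice points are removed.\<close>
  define X where "X = connected_component_set (- tiles F B) (centre a) - range emb"
  have "connected X"
    unfolding X_def
    by (intro connected_open_diff_countable open_component_tiles F) auto
  \<comment> \<open>A ball that avoids all copies of \<open>F\<close> is connected in the complement
    defining \<open>N c\<close>; if it meets \<open>N c\<close>, its centre lies in
    \<open>N c\<close> too.\<close>
  have "open L"
    unfolding open_contains_ball
  proof
    fix x assume x: "x \<in> L"
    have "open (- tiles F UNIV)" using F by (simp add: closed_tiles open_Compl)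
    with x obtain e where e: "e > 0" "ball x e \<subseteq> - tiles F UNIV"
      unfolding open_contains_ball L_def by blast
    have "y \<notin> N c" if "c \<notin> B" "y \<in> ball x e" for c y
    proof
      assume y: "y \<in> N c"
      have "connected_component (- tiles F (- {c})) y x"
        unfolding connected_component_def
        using e that tiles_mono[of "- {c}" UNIV F] centre_in_ball[of x e] connected_ball[of x e] by blast
      with y have "x \<in> N c"
        unfolding N_def by (auto intro: connected_component_trans)
      with x that show False by (auto simp: L_def)
    qed
    with e show "\<exists>e>0. ball x e \<subseteq> L" unfolding L_def by blast
  qed
  have disj: "nbhd F C \<inter> nbhd F C' = {}"
  proof (rule disjoint_nbhd[OF F(2)])
    show "C \<inter> C' = {}" by (auto simp: C'_def)
  qed (use Q(2) step in \<open>auto simp: C'_def\<close>)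
  have "L \<inter> nbhd F C = {}"
  proof (rule ccontr)
    assume "\<not> ?thesis"
    then obtain x where x: "x \<in> L" "x \<in> nbhd F C" by blast
    from F(2) x(2) show False
      by (rule nbhd_cases) (use x(1) CB in \<open>auto simp: L_def N_def tiles_def\<close>)
  qed
  with disj have disj': "nbhd F C \<inter> (nbhd F C' \<union> L) = {}" by blast
  have cover: "X \<subseteq> nbhd F C \<union> (nbhd F C' \<union> L)"
  proof
    fix x assume "x \<in> X"
    then have x: "x \<notin> tiles F B" "x \<notin> range emb"
      using connected_component_subset by (auto simp: X_def)
    have NC: "N c \<subseteq> nbhd F C \<union> nbhd F C'" if "c \<notin> B" for c
      using that by (auto simp: nbhd_def N_def C'_def)
    \<comment> \<open>The cases count the copies of \<open>F\<close> containing \<open>x\<close>: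
      none, exactly one, at least two.\<close>
    consider "x \<notin> tiles F UNIV"
      | c where "x - emb c \<in> F" "\<And>z. x - emb z \<in> F \<Longrightarrow> z = c"
      | c c' where "x - emb c \<in> F" "x - emb c' \<in> F" "c \<noteq> c'"
      unfolding tiles_def mem_Collect_eq by blast
    then show "x \<in> nbhd F C \<union> (nbhd F C' \<union> L)"
    proof cases
      case 1
      then show ?thesis using NC by (auto simp: L_def)
    next
      case (2 c)
      then have "c \<notin> B" "x \<notin> tiles F (- {c})" using x unfolding tiles_def by blast+
      moreover have "x \<in> cell c" using 2(1) F(2) unfolding mem_cell by blast
      ultimately have "x \<in> N c" using component_cell[OF F(2), of c "- {c}"] by (simp add: N_def)
      with \<open>c \<notin> B\<close> NC show ?thesis by blast
    next
      case (3 c c')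
      then have cB: "c \<notin> B" "c' \<notin> B" using x unfolding tiles_def by blast+
      have cells: "x \<in> cell c" "x \<in> cell c'" using 3 F(2) unfolding mem_cell by blast+
      \<comment> \<open>Off the lattice the two cells are side neighbours, so each is reachable from
        the other in one step.\<close>
      have "c' - c \<in> Q" "c - c' \<in> Q"
        using two_cells(1)[OF x(2) cells] two_cells(1)[OF x(2) cells(2,1)] 3 Q(1) by auto
      then have "c \<in> C \<longleftrightarrow> c' \<in> C" using step cB by blast
      moreover have "x \<notin> tiles unit_square (- {c, c'})"
        using two_cells(2)[OF x(2) cells] 3(3) unfolding tiles_def mem_cell by blast
      ultimately show ?thesis using cB unfolding nbhd_def C'_def by blast
    qed
  qed
  \<comment> \<open>Centres have half-integer coordinates, so they survive the removal of the
    lattice points; the contradiction is one of parity.\<close>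
  have nlat: "centre z \<notin> range emb" for z
  proof
    assume "centre z \<in> range emb"
    then obtain w where "real_of_int (fst z) + 1/2 = real_of_int (fst w)"
      by (auto simp: centre_def emb_def)
    then have "real_of_int (2 * fst z + 1) = real_of_int (2 * fst w)" by simp
    then have "2 * fst z + 1 = 2 * fst w" by (simp only: of_int_eq_iff)
    then show False by presburger
  qed
  have "centre z \<in> N z" for z
    using component_cell[OF F(2), of z "- {z}" "centre z"]
      open_cell_inter_tiles[OF F(2), of z "- {z}"] centre_in_open_cell[of z] open_cell_subset_cell[of z]
    by (auto simp: N_def)
  then have "centre z \<in> nbhd F E" if "z \<in> E" for z E
    using that unfolding nbhd_def N_def by blast
  moreover have "a \<in> C" "a' \<in> C'" using na a by (auto simp: C_def C'_def)
  moreover have "centre a \<in> X" "centre a' \<in> X"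
    using conn connected_component_in[OF conn] nlat
    by (auto simp: X_def connected_component_refl_eq)
  ultimately have "centre a \<in> X \<inter> nbhd F C" "centre a' \<in> X \<inter> nbhd F C'"
    by blast+
  moreover have "open (nbhd F C' \<union> L)" using F \<open>open L\<close> by (simp add: open_nbhd open_Un)
  ultimately show False
    using connectedD[OF \<open>connected X\<close> open_nbhd[OF F(1)], of "nbhd F C' \<union> L" C] cover disj' by blast
qed


section \<open>Admissibility as a connection between two cell centres; digits and supercells\<close>

text \<open>Centres stand for the open cells. Unlike \<open>admissible\<close>, the notion has no
  exceptional clause at order 0, so it can be applied to \<open>approx n D 0\<close> as
  well.\<close>

definition linked :: "plane set \<Rightarrow> lattice \<Rightarrow> bool" where
  "linked F q = connected_component (- tiles F (- {0, q})) (centre 0) (centre q)"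

text \<open>After scaling by \<open>n\<close> each unit cell becomes an \<open>n\<close> by
  \<open>n\<close> block of cells; this is the index of the block containing \<open>a\<close>, and
  \<open>residue\<close> is the position inside it.\<close>

definition supercell :: "nat \<Rightarrow> lattice \<Rightarrow> lattice" where
  "supercell n a = (fst a div int n, snd a div int n)"

definition residue :: "nat \<Rightarrow> lattice \<Rightarrow> lattice" where
  "residue n a = (fst a mod int n, snd a mod int n)"

definition scale :: "nat \<Rightarrow> lattice \<Rightarrow> lattice" where
  "scale n a = (int n * fst a, int n * snd a)"

lemma emb_scale: "emb (scale n a) = real n *\<^sub>R emb a"
  by (simp add: emb_def scale_def)

lemma residue_plus_scale: "residue n a + scale n (supercell n a) = a"
  by (simp add: residue_def scale_def supercell_def)

lemma residue_in_digits: "n \<ge> 1 \<Longrightarrow> residue n a \<in> digits n"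
  by (auto simp: residue_def digits_def)

lemma digits_plus_scale:
  assumes "h \<in> digits n"
  shows "residue n (h + scale n z) = h" "supercell n (h + scale n z) = z"
  using assms by (cases h; cases z; auto simp: digits_def residue_def supercell_def scale_def)+

lemma finite_digits: "finite (digits n)"
  by (simp add: digits_def)

lemma approx_subset_unit_square:
  assumes "n \<ge> 1" "D \<subseteq> digits n"
  shows "approx n D k \<subseteq> unit_square"
proof (induction k)
  case (Suc k)
  show ?case
  proof
    fix y assume "y \<in> approx n D (Suc k)"
    then obtain x d where xd: "y = (x + emb d) /\<^sub>R real n" "x \<in> unit_square" "d \<in> digits n"
      using Suc assms(2) unfolding approx.simps by blast
    then have "fst d \<le> int n - 1" "snd d \<le> int n - 1" by (auto simp: digits_def)
    then have "real_of_int (fst d) \<le> real n - 1" "real_of_int (snd d) \<le> real n - 1"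
      by linarith+
    with xd assms(1) show "y \<in> unit_square"
      by (auto simp: unit_square_def digits_def emb_def field_simps)
  qed
qed simp

lemma compact_approx:
  assumes "finite D"
  shows "compact (approx n D k)"
proof (induction k)
  case (Suc k)
  have "approx n D (Suc k) = (\<Union>d\<in>D. (\<lambda>x. (x + emb d) /\<^sub>R real n) ` approx n D k)"
    by auto
  also have "compact \<dots>"
    using Suc assms by (intro compact_UN compact_continuous_image continuous_intros) auto
  finally show ?case .
qed (simp add: compact_unit_square)

lemma H_eq_tiles: "H n D k q = tiles (approx n D k) (- {0, q})"
proof -
  have "(\<exists>y z. x = y + emb z \<and> y \<in> F \<and> z \<notin> {0, q}) \<longleftrightarrow> (\<exists>z\<in>- {0, q}. x - emb z \<in> F)" for x F
    by (metis ComplI ComplD add_diff_cancel_right' diff_add_cancel)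
  then show ?thesis unfolding H_def tiles_def by simp
qed

lemma connected_component_image:
  assumes "connected_component S x y" "continuous_on S f" "f ` S \<subseteq> T"
  shows "connected_component T (f x) (f y)"
proof -
  obtain U where U: "connected U" "U \<subseteq> S" "x \<in> U" "y \<in> U"
    using assms(1) by (auto simp: connected_component_def)
  then have "connected (f ` U)"
    using assms(2) by (blast intro: connected_continuous_image continuous_on_subset)
  with U assms(3) show ?thesis
    unfolding connected_component_def by blast
qed

lemma centre_notin_tiles: "F \<subseteq> unit_square \<Longrightarrow> c \<notin> B \<Longrightarrow> centre c \<notin> tiles F B"
  using open_cell_inter_tiles[of F c B] centre_in_open_cell[of c] by blast

lemma component_open_cell:
  assumes "F \<subseteq> unit_square" "c \<notin> B" "x \<in> open_cell c"
  shows "connected_component (- tiles F B) (centre c) x"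
  using component_cell[OF assms(1,2)] open_cell_inter_tiles[OF assms(1,2)] assms(3) open_cell_subset_cell[of c]
  by blast

text \<open>The open cells of \<open>0\<close> and \<open>q\<close> are connected and avoid
  \<open>H\<close>, so a component containing their centres contains them entirely.\<close>

lemma admissible_iff_linked:
  assumes "n \<ge> 1" "D \<subseteq> digits n" "k \<ge> 1"
  shows "q \<in> admissible n D k \<longleftrightarrow> linked (approx n D k) q"
proof -
  define U where "U = - H n D k q"
  have F: "approx n D k \<subseteq> unit_square" using assms approx_subset_unit_square by blast
  have sub: "open_cell c \<subseteq> connected_component_set U (centre c)" if "c \<in> {0, q}" for c
    using component_open_cell[OF F, of c "- {0, q}"] that by (auto simp: U_def H_eq_tiles)
  have "q \<in> admissible n D k \<longleftrightarrow> (\<exists>C\<in>components U. open_cell 0 \<subseteq> C \<and> open_cell q \<subseteq> C)"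
    using assms(3) translate_open_cell[of q 0] by (simp add: admissible_def interior_unit_square U_def)
  also have "\<dots> \<longleftrightarrow> connected_component U (centre 0) (centre q)"
  proof
    assume "\<exists>C\<in>components U. open_cell 0 \<subseteq> C \<and> open_cell q \<subseteq> C"
    then show "connected_component U (centre 0) (centre q)"
      unfolding connected_component_def
      using centre_in_open_cell in_components_connected in_components_subset by blast
  next
    assume conn: "connected_component U (centre 0) (centre q)"
    then have "connected_component_set U (centre 0) \<in> components U"
      using connected_component_in componentsI by blast
    moreover have "open_cell q \<subseteq> connected_component_set U (centre 0)"
      using sub[of q] connected_component_eq[of "centre q" U "centre 0"] conn by auto
    ultimately show "\<exists>C\<in>components U. open_cell 0 \<subseteq> C \<and> open_cell q \<subseteq> C"
      using sub[of 0] by blast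
  qed
  finally show ?thesis by (simp add: linked_def U_def H_eq_tiles)
qed

lemma linked_neighbour:
  assumes F: "F \<subseteq> unit_square" and q: "q \<in> {(0, 0), (1, 0), (-1, 0), (0, 1), (0, -1)}"
  shows "linked F q"
proof -
  \<comment> \<open>For a neighbour \<open>q\<close> this is the midpoint of the common side, which
    lies in no third cell; for \<open>q = 0\<close> it is the centre itself.\<close>
  define p where "p = (1/2) *\<^sub>R (centre 0 + centre q)"
  have "p \<in> cell 0" "p \<in> cell q"
    using q by (auto simp: p_def centre_def cell_def emb_def)
  moreover have "z \<in> {0, q}" if "p \<in> cell z" for z
  proof -
    have "real_of_int (fst z) \<le> fst p" "fst p \<le> real_of_int (fst z) + 1"
      "real_of_int (snd z) \<le> snd p" "snd p \<le> real_of_int (snd z) + 1"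
      using that by (auto simp: cell_def)
    then show ?thesis
      using q by (cases z) (auto simp: p_def centre_def emb_def zero_prod_def; linarith)
  qed
  then have "p \<notin> tiles F (- {0, q})"
    using F unfolding tiles_def mem_cell by blast
  ultimately have c: "connected_component (- tiles F (- {0, q})) (centre 0) p"
    and c': "connected_component (- tiles F (- {0, q})) (centre q) p"
    using component_cell[OF F] by auto
  show ?thesis
    unfolding linked_def by (rule connected_component_trans[OF c connected_component_sym[OF c']])
qed

text \<open>Lattice translations permute the copies of \<open>F\<close>. One implication, used with
  a vector and with its opposite, gives both directions.\<close>

lemma linked_translate:
  "linked F (b - a) \<longleftrightarrow> connected_component (- tiles F (- {a, b})) (centre a) (centre b)"
proof -
  have *: "connected_component (- tiles F (- {a + c, b + c})) (centre (a + c)) (centre (b + c))"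
    if "connected_component (- tiles F (- {a, b})) (centre a) (centre b)" for a b c
  proof -
    have "(\<lambda>x. x + emb c) ` (- tiles F (- {a, b})) \<subseteq> - tiles F (- {a + c, b + c})"
    proof clarsimp
      fix x y assume xy: "(x, y) \<notin> tiles F (- {a, b})" "(x, y) + emb c \<in> tiles F (- {a + c, b + c})"
      then obtain z where z: "z \<notin> {a + c, b + c}" "(x, y) + emb c - emb z \<in> F"
        unfolding tiles_def by blast
      then have "(x, y) - emb (z - c) \<in> F" by (simp add: emb_simps algebra_simps)
      moreover have "z - c \<notin> {a, b}" using z(1) by (auto simp: algebra_simps)
      ultimately show False using xy(1) unfolding tiles_def by blast
    qed
    from connected_component_image[OF that _ this] show ?thesis
      by (simp add: centre_def emb_simps algebra_simps continuous_intros)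
  qed
  show ?thesis
    using *[of 0 "b - a" a] *[of a b "- a"] by (auto simp: linked_def)
qed

lemma admissible_imp_linked:
  assumes "n \<ge> 1" "D \<subseteq> digits n" "q \<in> admissible n D k"
  shows "linked (approx n D k) q"
proof (cases "k = 0")
  case True
  with assms(3) show ?thesis by (intro linked_neighbour) (auto simp: admissible_def)
next
  case False
  with assms admissible_iff_linked[of n D k q] show ?thesis by simp
qed

lemma neighbour_admissible:
  assumes "n \<ge> 1" "D \<subseteq> digits n"
  shows "{(0, 0), (1, 0), (-1, 0), (0, 1), (0, -1)} \<subseteq> admissible n D k"
proof (cases "k = 0")
  case True
  then show ?thesis by (simp add: admissible_def)
next
  case False
  with admissible_iff_linked[OF assms] linked_neighbour approx_subset_unit_square[OF assms]
  show ?thesis by (metis One_nat_def Suc_leI neq0_conv subsetI)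
qed

text \<open>Opening both cells enlarges the complement, so the two components join through
  \<open>x\<close>. At order 0 the copies of the full square cover the plane, which forces
  \<open>c' = c\<close>.\<close>

lemma admissible_if_components_meet:
  assumes "n \<ge> 1" "D \<subseteq> digits n"
    and x: "connected_component (- tiles (approx n D k) (- {c})) (centre c) x"
      "connected_component (- tiles (approx n D k) (- {c'})) (centre c') x"
  shows "c' - c \<in> admissible n D k"
proof (cases "k = 0")
  case True
  obtain z where z: "x \<in> cell z" by (rule obtain_cell)
  with True component_tiles_unique[OF x(1), of z] component_tiles_unique[OF x(2), of z]
  have "c' = c" by (simp add: mem_cell)
  then show ?thesis using neighbour_admissible[OF assms(1,2)] by (simp add: zero_prod_def)
next
  case False
  let ?U = "- tiles (approx n D k) (- {c, c'})"
  have c: "connected_component ?U (centre c) x" and c': "connected_component ?U (centre c') x"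
    by (rule x[THEN connected_component_of_subset], intro Compl_anti_mono tiles_mono, blast)+
  have "connected_component ?U (centre c) (centre c')"
    using connected_component_trans[OF c connected_component_sym[OF c']] .
  with False show ?thesis
    using admissible_iff_linked[OF assms(1,2)] by (simp add: linked_translate)
qed

section \<open>From order \<open>k\<close> to order \<open>k + 1\<close>: scaling and chains of
  cells\<close>

definition blocked :: "nat \<Rightarrow> lattice set \<Rightarrow> lattice \<Rightarrow> lattice set" where
  "blocked n D q = {a. residue n a \<in> D \<and> supercell n a \<notin> {0, q}}"

text \<open>Division with remainder, \<open>a = d + scale n z\<close>, matches the pairs of a digit
  \<open>d\<close> in \<open>D\<close> and an index \<open>z\<close> outside \<open>{0, q}\<close>
  with the blocked cells.\<close>

lemma tiles_approx_Suc:
  assumes "n \<ge> 1" "D \<subseteq> digits n"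
  shows "x \<in> tiles (approx n D (Suc k)) (- {0, q}) \<longleftrightarrow>
    real n *\<^sub>R x \<in> tiles (approx n D k) (blocked n D q)"
proof
  assume "x \<in> tiles (approx n D (Suc k)) (- {0, q})"
  then obtain z y d where z: "z \<notin> {0, q}" and d: "d \<in> D" and y: "y \<in> approx n D k"
    and "x - emb z = (y + emb d) /\<^sub>R real n"
    unfolding tiles_def approx.simps by blast
  then have "real n *\<^sub>R (x - emb z) = y + emb d" using assms(1) by simp
  then have "real n *\<^sub>R x - emb (d + scale n z) = y"
    by (simp add: emb_simps emb_scale algebra_simps)
  moreover have "d + scale n z \<in> blocked n D q"
    using z d assms(2) by (auto simp: blocked_def digits_plus_scale)
  ultimately show "real n *\<^sub>R x \<in> tiles (approx n D k) (blocked n D q)"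
    using y unfolding tiles_def by blast
next
  assume "real n *\<^sub>R x \<in> tiles (approx n D k) (blocked n D q)"
  then obtain a where a: "a \<in> blocked n D q" "real n *\<^sub>R x - emb a \<in> approx n D k"
    unfolding tiles_def by blast
  define y where "y = real n *\<^sub>R x - emb a"
  have "emb a = emb (residue n a) + real n *\<^sub>R emb (supercell n a)"
    by (metis residue_plus_scale emb_simps(2) emb_scale)
  then have "real n *\<^sub>R (x - emb (supercell n a)) = y + emb (residue n a)"
    by (simp add: y_def algebra_simps)
  then have "x - emb (supercell n a) = (y + emb (residue n a)) /\<^sub>R real n"
    using assms(1) by (simp flip: \<open>real n *\<^sub>R _ = _\<close>)
  with a show "x \<in> tiles (approx n D (Suc k)) (- {0, q})"
    unfolding tiles_def blocked_def y_def approx.simps by blast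
qed


text \<open>Scaling by \<open>n\<close> identifies the two complements. Any small cells
  \<open>a\<close> and \<open>a'\<close> of the two supercells will do, since each supercell has an
  open unobstructed interior.\<close>

lemma linked_Suc:
  assumes n: "n \<ge> 1" and D: "D \<subseteq> digits n" and a: "supercell n a = 0" "supercell n a' = q"
  shows "linked (approx n D (Suc k)) q \<longleftrightarrow>
    connected_component (- tiles (approx n D k) (blocked n D q)) (centre a) (centre a')"
    (is "_ \<longleftrightarrow> connected_component ?T _ _")
proof -
  let ?S = "- tiles (approx n D (Suc k)) (- {0, q})"
  note Suc_iff = tiles_approx_Suc[OF n D, of _ k q]
  have up: "connected_component ?T (real n *\<^sub>R x) (real n *\<^sub>R y)" if "connected_component ?S x y" for x y
    by (rule connected_component_image[OF that]) (use Suc_iff in \<open>auto simp del: approx.simps intro: continuous_on_scaleR continuous_on_const continuous_on_id\<close>)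
  have down: "connected_component ?S (x /\<^sub>R real n) (y /\<^sub>R real n)" if "connected_component ?T x y" for x y
    by (rule connected_component_image[OF that])
      (use Suc_iff[of "_ /\<^sub>R real n"] n in \<open>auto simp del: approx.simps intro: continuous_on_scaleR continuous_on_const continuous_on_id\<close>)
  \<comment> \<open>Scaled back, the centre of a small cell with digit \<open>h\<close> has offset
    \<open>(h + 1/2) / n\<close>, strictly between 0 and 1 in each coordinate.\<close>
  have centre: "connected_component ?S (centre (supercell n c)) (centre c /\<^sub>R real n)"
    if "supercell n c \<in> {0, q}" for c
  proof (rule component_open_cell[OF approx_subset_unit_square[OF n D]])
    define h where "h = residue n c"
    have "h \<in> digits n" using n by (simp add: h_def residue_in_digits)
    then have "0 \<le> fst h" "fst h \<le> int n - 1" "0 \<le> snd h" "snd h \<le> int n - 1"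
      by (auto simp: digits_def)
    then have "0 \<le> real_of_int (fst h)" "real_of_int (fst h) \<le> real n - 1"
      "0 \<le> real_of_int (snd h)" "real_of_int (snd h) \<le> real n - 1"
      by linarith+
    moreover have "centre c = emb h + real n *\<^sub>R emb (supercell n c) + (1/2, 1/2)"
      unfolding centre_def h_def by (metis residue_plus_scale emb_simps(2) emb_scale)
    ultimately show "centre c /\<^sub>R real n \<in> open_cell (supercell n c)"
      using n by (auto simp: open_cell_def emb_def field_simps)
  qed (use that in auto)
  have centre0: "connected_component ?S (centre 0) (centre a /\<^sub>R real n)"
    and centreq: "connected_component ?S (centre q) (centre a' /\<^sub>R real n)"
    using centre[of a] centre[of a'] a by auto
  show ?thesis
  proof
    assume "linked (approx n D (Suc k)) q"
    then have "connected_component ?S (centre a /\<^sub>R real n) (centre a' /\<^sub>R real n)"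
      unfolding linked_def
      by (rule connected_component_trans[OF connected_component_sym[OF centre0]
            connected_component_trans[OF _ centreq]])
    from up[OF this] show "connected_component ?T (centre a) (centre a')" using n by simp
  next
    assume "connected_component ?T (centre a) (centre a')"
    from down[OF this] show "linked (approx n D (Suc k)) q"
      unfolding linked_def
      by (rule connected_component_trans[OF centre0
            connected_component_trans[OF _ connected_component_sym[OF centreq]]])
  qed
qed

abbreviation moves :: "lattice set \<Rightarrow> lattice set \<Rightarrow> (lattice \<times> lattice) set" where
  "moves B Q \<equiv> {(c, c'). c \<notin> B \<and> c' \<notin> B \<and> c' - c \<in> Q}"

text \<open>Each move is linked even with all copies other than those at its two ends present;
  keeping only the blocked ones enlarges the complement.\<close>

lemma connected_if_chain:
  assumes "F \<subseteq> unit_square" "\<And>q. q \<in> Q \<Longrightarrow> linked F q" "(a, a') \<in> (moves B Q)\<^sup>*" "a \<notin> B"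
  shows "connected_component (- tiles F B) (centre a) (centre a')"
  using assms(3)
proof induction
  case base
  then show ?case using centre_notin_tiles[OF assms(1,4)] by (simp add: connected_component_refl_eq)
next
  case (step c c')
  then have c: "c \<notin> B" "c' \<notin> B" "c' - c \<in> Q" by auto
  have "connected_component (- tiles F (- {c, c'})) (centre c) (centre c')"
    using assms(2)[OF c(3)] by (simp add: linked_translate)
  moreover have "tiles F B \<subseteq> tiles F (- {c, c'})" using c by (intro tiles_mono) auto
  ultimately have "connected_component (- tiles F B) (centre c) (centre c')"
    using connected_component_of_subset by (metis Compl_subset_Compl_iff)
  with step.IH show ?case by (rule connected_component_trans)
qed

lemma admissible_Suc_iff:
  assumes n: "n \<ge> 1" and D: "D \<subseteq> digits n"
  shows "q \<in> admissible n D (Suc k) \<longleftrightarrow> (\<exists>a a'. supercell n a = 0 \<and> supercell n a' = q \<and>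
    (a, a') \<in> (moves (blocked n D q) (admissible n D k))\<^sup>*)"
proof -
  have F: "approx n D k \<subseteq> unit_square" "compact (approx n D k)"
    using approx_subset_unit_square[OF n D] compact_approx finite_subset[OF D finite_digits] by auto
  have free: "a \<notin> blocked n D q" if "supercell n a \<in> {0, q}" for a
    using that by (auto simp: blocked_def)
  have "q \<in> admissible n D (Suc k) \<longleftrightarrow> linked (approx n D (Suc k)) q"
    using admissible_iff_linked[OF n D] by simp
  also have "\<dots> \<longleftrightarrow> (\<exists>a a'. supercell n a = 0 \<and> supercell n a' = q \<and>
    (a, a') \<in> (moves (blocked n D q) (admissible n D k))\<^sup>*)"
  proof
    assume linked: "linked (approx n D (Suc k)) q"
    \<comment> \<open>For this direction one pair of cells suffices: the lower left cell of each
      supercell.\<close>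
    have sc: "supercell n 0 = 0" "supercell n (scale n q) = q"
      using n by (auto simp: supercell_def scale_def zero_prod_def)
    have "(0, scale n q) \<in> (moves (blocked n D q) (admissible n D k))\<^sup>*"
    proof (rule chain_if_connected[OF F(2,1)])
      show "connected_component (- tiles (approx n D k) (blocked n D q)) (centre 0) (centre (scale n q))"
        using linked linked_Suc[OF n D sc] by simp
    qed (use neighbour_admissible[OF n D] admissible_if_components_meet[OF n D] free sc in auto)
    with sc show "\<exists>a a'. supercell n a = 0 \<and> supercell n a' = q \<and>
      (a, a') \<in> (moves (blocked n D q) (admissible n D k))\<^sup>*" by blast
  next
    assume "\<exists>a a'. supercell n a = 0 \<and> supercell n a' = q \<and>
      (a, a') \<in> (moves (blocked n D q) (admissible n D k))\<^sup>*"
    then obtain a a' where a: "supercell n a = 0" "supercell n a' = q"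
      and chain: "(a, a') \<in> (moves (blocked n D q) (admissible n D k))\<^sup>*" by blast
    have "connected_component (- tiles (approx n D k) (blocked n D q)) (centre a) (centre a')"
      by (rule connected_if_chain[OF F(1) _ chain])
        (use admissible_imp_linked[OF n D] free a in auto)
    then show "linked (approx n D (Suc k)) q" using linked_Suc[OF n D a] by simp
  qed
  finally show ?thesis .
qed

section \<open>Edge sequences as chains of cells\<close>

text \<open>An edge is a move from digit \<open>h\<close> to digit \<open>h'\<close> in which the
  supercell index changes by \<open>b\<close>.\<close>

lemma is_edge_iff:
  assumes "n \<ge> 1"
  shows "is_edge n Q (emb h /\<^sub>R real n, emb h' /\<^sub>R real n, b) \<longleftrightarrow> h' + scale n b - h \<in> Q"
proof -
  have "real n *\<^sub>R (emb h' /\<^sub>R real n + emb b - emb h /\<^sub>R real n) = emb (h' + scale n b - h)"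
    using assms by (simp add: emb_simps emb_scale algebra_simps)
  then show ?thesis
    using inj_emb by (simp add: is_edge_def inj_image_mem_iff)
qed

text \<open>Shortness of the chain keeps its interior away from the supercells of \<open>0\<close> and \<open>q\<close>, where
  the moves are also allowed to visit the digits in \<open>D\<close>.\<close>

lemma obtain_shortest_chain:
  assumes "supercell n a = 0" "supercell n a' = q" "(a, a') \<in> (moves (blocked n D q) Q)\<^sup>*" "q \<noteq> 0"
  obtains N f where "supercell n (f 0) = 0" "supercell n (f (Suc N)) = q"
    "\<And>i. i \<le> N \<Longrightarrow> f (Suc i) - f i \<in> Q"
    "\<And>i. 1 \<le> i \<Longrightarrow> i \<le> N \<Longrightarrow> residue n (f i) \<notin> D"
proof -
  define r where "r = moves (blocked n D q) Q"
  \<comment> \<open>The endpoints vary over both supercells, so a chain cut at an interior cell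
    lying in one of them is a shorter competitor.\<close>
  define P where "P = (\<lambda>M. \<exists>c c'. supercell n c = 0 \<and> supercell n c' = q \<and> (c, c') \<in> r ^^ M)"
  obtain M0 where "(a, a') \<in> r ^^ M0"
    using rtrancl_imp_relpow[OF assms(3)] unfolding r_def by blast
  with assms(1,2) have "P M0" unfolding P_def by blast
  define M where "M = (LEAST M. P M)"
  have "P M" unfolding M_def by (rule LeastI[of P]) fact
  have least: "M \<le> M'" if "P M'" for M' unfolding M_def using that by (rule Least_le)
  obtain f where f: "supercell n (f 0) = 0" "supercell n (f M) = q"
    "\<And>i. i < M \<Longrightarrow> (f i, f (Suc i)) \<in> r"
    using \<open>P M\<close> unfolding P_def relpow_fun_conv by blast
  have "M \<noteq> 0" using f assms(4) by (cases "M = 0") auto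
  then obtain N where N: "M = Suc N" by (cases M) auto
  have "residue n (f i) \<notin> D" if i: "1 \<le> i" "i \<le> N" for i
  proof
    assume "residue n (f i) \<in> D"
    moreover have "f i \<notin> blocked n D q" using f(3)[of i] i N by (simp add: r_def)
    ultimately have "supercell n (f i) = 0 \<or> supercell n (f i) = q" by (auto simp: blocked_def)
    then show False
    proof
      assume "supercell n (f i) = 0"
      moreover have "(f i, f M) \<in> r ^^ (M - i)"
        unfolding relpow_fun_conv using f(3) i N by (intro exI[of _ "\<lambda>j. f (i + j)"]) auto
      ultimately have "P (M - i)" using f(2) unfolding P_def by blast
      with least[of "M - i"] i N show False by auto
    next
      assume "supercell n (f i) = q"
      moreover have "(f 0, f i) \<in> r ^^ i"
        unfolding relpow_fun_conv using f(3) i N by (intro exI[of _ f]) auto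
      ultimately have "P i" using f(1) unfolding P_def by blast
      with least[of i] i N show False by auto
    qed
  qed
  moreover have "f (Suc i) - f i \<in> Q" if "i \<le> N" for i
    using f(3)[of i] that N by (simp add: r_def)
  ultimately show thesis using that f(1,2) N by blast
qed

theorem theorem4p4:
  fixes n k :: nat and D :: "lattice set"
  assumes "n \<ge> 2"
    and "D \<subseteq> digits n"
    and "1 < card D" and "card D < n ^ 2"
    and "k \<ge> 1"
  shows "admissible n D k =
    {q. \<exists>(m :: nat) (u :: nat \<Rightarrow> plane) (b :: nat \<Rightarrow> lattice).
        q = (\<Sum>i = 0..m. b i) \<and>
        (m = 0 \<longrightarrow> (u 0, u 1, b 0) \<in> Gtilde n (admissible n D (k - 1))) \<and>
        (m = 1 \<longrightarrow> (u 0, u 1, b 0) \<in> G' n D (admissible n D (k - 1)) \<and>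
                   (u 1, u 2, b 1) \<in> G'' n D (admissible n D (k - 1))) \<and>
        (m \<ge> 2 \<longrightarrow> (u 0, u 1, b 0) \<in> G' n D (admissible n D (k - 1)) \<and>
                   (\<forall>i \<in> {1..m - 1}. (u i, u (i + 1), b i) \<in> G n D (admissible n D (k - 1))) \<and>
                   (u m, u (m + 1), b m) \<in> G'' n D (admissible n D (k - 1)))}"
proof -
  define Q where "Q = admissible n D (k - 1)"
  obtain j where j: "k = Suc j" using assms(5) by (cases k) auto
  then have Qj: "Q = admissible n D j" by (simp add: Q_def)
  have n: "n \<ge> 1" using assms(1) by simp
  note D = assms(2)
  \<comment> \<open>A uniform form of the three cases for \<open>m\<close>: every vertex is in
    \<open>Vtilde n\<close>, and those with index from 1 to \<open>m\<close> are in
    \<open>V n D\<close>.\<close>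
  define E where "E = (\<lambda>m u b. (\<forall>i\<le>m. u i \<in> Vtilde n \<and> u (Suc i) \<in> Vtilde n \<and>
    is_edge n Q (u i, u (Suc i), b i) \<and> (1 \<le> i \<longrightarrow> u i \<in> V n D)))"
  have VV: "x \<in> V n D \<Longrightarrow> x \<in> Vtilde n" for x by (auto simp: V_def Vtilde_def)
  have E_iff: "E m u b \<longleftrightarrow> (m = 0 \<longrightarrow> (u 0, u 1, b 0) \<in> Gtilde n Q) \<and>
        (m = 1 \<longrightarrow> (u 0, u 1, b 0) \<in> G' n D Q \<and> (u 1, u 2, b 1) \<in> G'' n D Q) \<and>
        (m \<ge> 2 \<longrightarrow> (u 0, u 1, b 0) \<in> G' n D Q \<and>
                   (\<forall>i \<in> {1..m - 1}. (u i, u (i + 1), b i) \<in> G n D Q) \<and>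
                   (u m, u (m + 1), b m) \<in> G'' n D Q)" for m u b
  proof -
    consider "m = 0" | "m = 1" | "m \<ge> 2" by linarith
    then show ?thesis
    proof cases
      case 3
      let ?R = "(u 0, u 1, b 0) \<in> G' n D Q \<and> (\<forall>i \<in> {1..m - 1}. (u i, u (i + 1), b i) \<in> G n D Q) \<and>
        (u m, u (m + 1), b m) \<in> G'' n D Q"
      have "E m u b \<longleftrightarrow> ?R"
      proof
        assume E: "E m u b"
        have EV: "u i \<in> V n D" if "1 \<le> i" "i \<le> m" for i using E that by (simp add: E_def)
        have "u 1 \<in> V n D" "u m \<in> V n D" using 3 by (simp_all add: EV)
        moreover have "u i \<in> V n D \<and> u (i + 1) \<in> V n D" if "i \<in> {1..m - 1}" for i
          using EV[of i] EV[of "i + 1"] that 3 by simp linarith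
        ultimately show ?R
          using E 3 by (auto simp: E_def G_def G'_def G''_def)
      next
        assume R: ?R
        show "E m u b"
          unfolding E_def
        proof (intro allI impI)
          fix i assume "i \<le> m"
          then consider "i = 0" | "i = m" | "i \<in> {1..m - 1}" by force
          then show "u i \<in> Vtilde n \<and> u (Suc i) \<in> Vtilde n \<and>
            is_edge n Q (u i, u (Suc i), b i) \<and> (1 \<le> i \<longrightarrow> u i \<in> V n D)"
          proof cases
            case 3
            with R have "(u i, u (i + 1), b i) \<in> G n D Q" by blast
            then show ?thesis using VV by (simp add: G_def)
          qed (use R VV in \<open>simp_all add: G'_def G''_def\<close>)
        qed
      qed
      with 3 show ?thesis by simp
    qed (auto simp: E_def Gtilde_def G'_def G''_def numeral_2_eq_2 le_Suc_eq intro: VV)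
  qed
  have "q \<in> admissible n D k \<longleftrightarrow> (\<exists>m u b. q = (\<Sum>i = 0..m. b i) \<and> E m u b)" for q
  proof
    assume q: "q \<in> admissible n D k"
    show "\<exists>m u b. q = (\<Sum>i = 0..m. b i) \<and> E m u b"
    \<comment> \<open>For \<open>q = 0\<close> a shortest chain may have no moves, whereas at least
      one edge is required; the zero edge serves.\<close>
    proof (cases "q = 0")
      case True
      have "(0, 0) \<in> digits n" using n by (auto simp: digits_def)
      then have "emb 0 /\<^sub>R real n \<in> Vtilde n" by (auto simp: Vtilde_def zero_prod_def)
      moreover have "is_edge n Q (emb 0 /\<^sub>R real n, emb 0 /\<^sub>R real n, 0)"
        using is_edge_iff[OF n, of Q 0 0 0] neighbour_admissible[OF n D, of j]
        by (auto simp: Qj scale_def zero_prod_def)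
      ultimately have "E 0 (\<lambda>_. emb 0 /\<^sub>R real n) (\<lambda>_. 0)"
        unfolding E_def by auto
      with True show ?thesis by (intro exI[of _ 0] exI[of _ "\<lambda>_. emb 0 /\<^sub>R real n"] exI[of _ "\<lambda>_. 0"]) simp
    next
      case False
      from q obtain a a' where "supercell n a = 0" "supercell n a' = q"
        "(a, a') \<in> (moves (blocked n D q) Q)\<^sup>*"
        unfolding j Qj admissible_Suc_iff[OF n D] by blast
      from obtain_shortest_chain[OF this False] obtain N f where
        f: "supercell n (f 0) = 0" "supercell n (f (Suc N)) = q"
        "\<And>i. i \<le> N \<Longrightarrow> f (Suc i) - f i \<in> Q"
        "\<And>i. 1 \<le> i \<Longrightarrow> i \<le> N \<Longrightarrow> residue n (f i) \<notin> D" by metis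
      \<comment> \<open>The digits of the cells become the vertices and the changes of supercell the
        edge labels, whose sum telescopes to \<open>q\<close>.\<close>
      define u where "u = (\<lambda>i. emb (residue n (f i)) /\<^sub>R real n)"
      define b where "b = (\<lambda>i. supercell n (f (Suc i)) - supercell n (f i))"
      have "(\<Sum>i = 0..m. b i) = supercell n (f (Suc m)) - supercell n (f 0)" for m
        by (induction m) (auto simp: b_def)
      moreover have "E N u b"
        unfolding E_def
      proof (intro allI impI conjI)
        fix i assume i: "i \<le> N"
        show "u i \<in> Vtilde n" "u (Suc i) \<in> Vtilde n"
          unfolding u_def Vtilde_def by (intro imageI residue_in_digits[OF n])+
        show "u i \<in> V n D" if "1 \<le> i"
          unfolding u_def V_def by (intro imageI DiffI residue_in_digits[OF n] f(4)[OF that i])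
        have "residue n (f (Suc i)) + scale n (b i) - residue n (f i) = f (Suc i) - f i"
          by (auto simp: b_def residue_def supercell_def scale_def prod_eq_iff algebra_simps
              minus_mult_div_eq_mod[symmetric])
        then show "is_edge n Q (u i, u (Suc i), b i)"
          unfolding u_def is_edge_iff[OF n] using f(3)[OF i] by simp
      qed
      ultimately show ?thesis using f(1,2) by (metis diff_zero)
    qed
  next
    assume "\<exists>m u b. q = (\<Sum>i = 0..m. b i) \<and> E m u b"
    then obtain m u b where q: "q = (\<Sum>i = 0..m. b i)" and E: "E m u b" by blast
    have "\<exists>h\<in>digits n. u i = emb h /\<^sub>R real n \<and> (1 \<le> i \<and> i \<le> m \<longrightarrow> h \<notin> D)" if "i \<le> Suc m" for i
    proof (cases "1 \<le> i \<and> i \<le> m")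
      case True
      with E have "u i \<in> V n D" by (auto simp: E_def)
      then show ?thesis by (auto simp: V_def)
    next
      case False
      have "u i \<in> Vtilde n" using E that by (cases "i = Suc m") (auto simp: E_def)
      with False show ?thesis by (auto simp: Vtilde_def)
    qed
    then obtain h where h: "\<And>i. i \<le> Suc m \<Longrightarrow> h i \<in> digits n"
      "\<And>i. i \<le> Suc m \<Longrightarrow> u i = emb (h i) /\<^sub>R real n"
      "\<And>i. 1 \<le> i \<Longrightarrow> i \<le> m \<Longrightarrow> h i \<notin> D" by (metis le_SucI)
    \<comment> \<open>The inverse construction: digit \<open>h i\<close> is placed in the supercell
      reached by the labels before \<open>i\<close>, so the chain starts in supercell 0 and ends in
      supercell \<open>q\<close>.\<close>
    define a where "a = (\<lambda>i. h i + scale n (\<Sum>l<i. b l))"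
    have sc: "supercell n (a i) = (\<Sum>l<i. b l)" "residue n (a i) = h i" if "i \<le> Suc m" for i
      using h(1)[OF that] by (auto simp: a_def digits_plus_scale)
    have ends: "supercell n (a 0) = 0" "supercell n (a (Suc m)) = q"
      using sc[of 0] sc[of "Suc m"] q by (simp_all add: atLeast0AtMost lessThan_Suc_atMost)
    \<comment> \<open>The end cells are free because of their supercells, the interior ones because
      their digits are outside \<open>D\<close>.\<close>
    have free: "a i \<notin> blocked n D q" if i: "i \<le> Suc m" for i
    proof -
      consider "i = 0" | "1 \<le> i \<and> i \<le> m" | "i = Suc m" using i by force
      then show ?thesis
        using ends h(3)[of i] sc(2)[OF i] by cases (auto simp: blocked_def)
    qed
    have step: "(a i, a (Suc i)) \<in> moves (blocked n D q) Q" if "i \<le> m" for i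
    proof -
      have "is_edge n Q (u i, u (Suc i), b i)" using E that by (simp add: E_def)
      then have "h (Suc i) + scale n (b i) - h i \<in> Q"
        using h(2)[of i] h(2)[of "Suc i"] that by (simp add: is_edge_iff[OF n])
      also have "h (Suc i) + scale n (b i) - h i = a (Suc i) - a i"
        by (auto simp: a_def scale_def prod_eq_iff algebra_simps)
      finally show ?thesis using free[of i] free[of "Suc i"] that by simp
    qed
    have "(a 0, a i) \<in> (moves (blocked n D q) Q)\<^sup>*" if "i \<le> Suc m" for i
      using that by (induction i) (use step in \<open>auto intro: rtrancl_into_rtrancl\<close>)
    with ends show "q \<in> admissible n D k"
      unfolding j Qj[symmetric] admissible_Suc_iff[OF n D] using Qj by blast
  qed
  then have "admissible n D k = {q. \<exists>m u b. q = (\<Sum>i = 0..m. b i) \<and> E m u b}" by blast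
  then show ?thesis unfolding E_iff Q_def by blast
qed

end
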